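(* The full embedding $(\mathbf{Met},d_{GH})\to(\mathbf{F}_{\mathbb{R}}\mathbf{Cl},d_{GH})$, $(X,d)\mapsto(X_\bullet,c_{\bullet,d})$, is an isometric embedding of (large) Lawvere metric spaces. That is, for all metric spaces $(X,d)$ and $(Y,e)$, the classical Gromov–Hausdorff distance $d_{GH}((X,d),(Y,e))$ equals the Gromov–Hausdorff distance $d_{GH}((X_\bullet,c_{\bullet,d}),(Y_\bullet,c_{\bullet,e}))$ of the associated $\mathbb{R}$-filtrations of closure spaces.
   Context: A (Čech) closure space $(X,c)$ is a set $X$ with a function $c:2^X\to 2^X$ such that $c(\varnothing)=\varnothing$, $A\subset c(A)$, and $c(A\cup B)=c(A)\cup c(B)$. Continuous maps $f:(X,c_X)\to(Y,c_Y)$ satisfy $f(c_X(A))\subset c_Y(f(A))$; $\mathbf{Cl}$ is the resulting category. An $\mathbb{R}$-filtration of closure spaces is a functor $(\mathbb{R},\le)\to\mathbf{Cl}$ sending each $s\le t$ to a monomorphism (injective continuous map); with natural transformations these form $\mathbf{F}_{\mathbb{R}}\mathbf{Cl}$. It is an $\mathbb{R}$-filtered closure space if the maps are subset inclusions; then $X:=\bigcup_tX_t$. $\mathbf{Met}$ is the category of metric spaces and $1$-Lipschitz maps. The full embedding $\mathbf{Met}\to\mathbf{F}_{\mathbb{R}}\mathbf{Cl}$ sends $(X,d)$ to the $\mathbb{R}$-filtered closure space with $X_t=\varnothing$ for $t<0$, $X_t=X$ for $t\ge0$, and $c_{t,d}(A)=\{x\in X\mid d(a,x)\le t$ for some $a\in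 A\}$ for $t\ge 0$; morphisms are sent to themselves. A multivalued map $C:X\rightrightarrows Y$ is a subset $C\subset X\times Y$ projecting onto $X$; write $xCy$ for $(x,y)\in C$, $C(A)=\{y\mid\exists a\in A,\ aCy\}$. It is a correspondence if it also projects onto $Y$; $C^T=\{(y,x)\mid xCy\}$. A function $f:X\to Y$ is subordinate to $C$ if $xCf(x)$ for all $x$. Metric spaces: $C$ is a metric $\varepsilon$-multivalued map if $xCy$, $x'Cy'$ imply $e(y,y')\le d(x,x')+\varepsilon$; a correspondence $C$ is a metric $\varepsilon$-correspondence if $C$ and $C^T$ are metric $\varepsilon$-multivalued maps; $\mathrm{mdist}(C)=\inf\{\varepsilon\ge0\mid C$ is a metric $\varepsilon$-correspondence$\}$ ($\infty$ if none); $d_{GH}((X,d),(Y,e))=\frac12\inf_C\mathrm{mdist}(C)$ over all correspondences $C:X\rightrightarrows Y$. $\mathbb{R}$-filtered closure spaces: a multivalued map $C:X\rightrightarrows Y$ is an $\varepsilon$-multivalued map from $X_\bullet$ to $Y_\bullet$ if for all $t$: (1) $x\in X_t$ and $xCy$ imply $y\in Y_{t+\varepsilon}$; (2) for all $A\subset X_t$ and all $f:X\to Y$ subordinate to $C$, $C(c_{X_t}(A))\subset c_{Y_{t+\varepsilon}}(f(A))$. A correspondence $C$ is an $\varepsilon$-correspondence if $C$ and $C^T$ are $\varepsilon$-multivalued maps; $\mathrm{dist}(C)$ is the infimum of $\varepsilon\ge0$ such that $C$ is an $\varepsilon$-correspondence ($\infty$ if none); $d_{GH}(X_\bullet,Y_\bullet)=\frac12\inf_C\mathrm{dist}(C)$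 over all correspondences. (For general $\mathbb{R}$-filtrations, $d_{GH}$ is defined by replacing them by isomorphic $\mathbb{R}$-filtered closure spaces.) A Lawvere metric space is a category enriched over the monoidal poset $(([0,\infty],\ge),+,0)$, i.e. a class with a $[0,\infty]$-valued distance vanishing on the diagonal and satisfying the triangle inequality. *)

theory Defs
  imports "HOL-Analysis.Analysis"
begin

section \<open>Categories\<close>

text \<open>
  Functions between sets are represented extensionally (as in \<open>\<rightarrow>\<^sub>E\<close>), so that equality in HOL is
  equality of morphisms. The first argument of the composition is the domain of the composite.
\<close>

record ('o, 'm) category =
  Obj :: "'o set"
  Hom :: "'o \<Rightarrow> 'o \<Rightarrow> 'm set"
  Ident :: "'o \<Rightarrow> 'm"
  Comp :: "'o \<Rightarrow> 'm \<Rightarrow> 'm \<Rightarrow> 'm"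

definition is_category :: "('o, 'm) category \<Rightarrow> bool" where
  "is_category C \<longleftrightarrow>
     (\<forall>x\<in>Obj C. Ident C x \<in> Hom C x x) \<and>
     (\<forall>x\<in>Obj C. \<forall>y\<in>Obj C. \<forall>z\<in>Obj C. \<forall>f\<in>Hom C x y. \<forall>g\<in>Hom C y z. Comp C x g f \<in> Hom C x z) \<and>
     (\<forall>x\<in>Obj C. \<forall>y\<in>Obj C. \<forall>f\<in>Hom C x y.
        Comp C x f (Ident C x) = f \<and> Comp C x (Ident C y) f = f) \<and>
     (\<forall>w\<in>Obj C. \<forall>x\<in>Obj C. \<forall>y\<in>Obj C. \<forall>z\<in>Obj C.
        \<forall>f\<in>Hom C w x. \<forall>g\<in>Hom C x y. \<forall>h\<in>Hom C y z.
        Comp C w h (Comp C w g f) = Comp C w (Comp C x h g) f)"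

definition is_functor ::
  "('o, 'm) category \<Rightarrow> ('p, 'n) category \<Rightarrow> ('o \<Rightarrow> 'p) \<Rightarrow> ('o \<Rightarrow> 'o \<Rightarrow> 'm \<Rightarrow> 'n) \<Rightarrow> bool" where
  "is_functor C D F0 F1 \<longleftrightarrow>
     is_category C \<and> is_category D \<and>
     (\<forall>x\<in>Obj C. F0 x \<in> Obj D) \<and>
     (\<forall>x\<in>Obj C. \<forall>y\<in>Obj C. \<forall>f\<in>Hom C x y. F1 x y f \<in> Hom D (F0 x) (F0 y)) \<and>
     (\<forall>x\<in>Obj C. F1 x x (Ident C x) = Ident D (F0 x)) \<and>
     (\<forall>x\<in>Obj C. \<forall>y\<in>Obj C. \<forall>z\<in>Obj C. \<forall>f\<in>Hom C x y. \<forall>g\<in>Hom C y z.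
        F1 x z (Comp C x g f) = Comp D (F0 x) (F1 y z g) (F1 x y f))"

definition full_embedding ::
  "('o, 'm) category \<Rightarrow> ('p, 'n) category \<Rightarrow> ('o \<Rightarrow> 'p) \<Rightarrow> ('o \<Rightarrow> 'o \<Rightarrow> 'm \<Rightarrow> 'n) \<Rightarrow> bool" where
  "full_embedding C D F0 F1 \<longleftrightarrow>
     is_functor C D F0 F1 \<and>
     inj_on F0 (Obj C) \<and>
     (\<forall>x\<in>Obj C. \<forall>y\<in>Obj C. bij_betw (F1 x y) (Hom C x y) (Hom D (F0 x) (F0 y)))"

section \<open>Lawvere metric spaces\<close>

definition lawvere_metric_space :: "'o set \<Rightarrow> ('o \<Rightarrow> 'o \<Rightarrow> ennreal) \<Rightarrow> bool" where
  "lawvere_metric_space S \<delta> \<longleftrightarrow>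
     (\<forall>x\<in>S. \<delta> x x = 0) \<and>
     (\<forall>x\<in>S. \<forall>y\<in>S. \<forall>z\<in>S. \<delta> x z \<le> \<delta> x y + \<delta> y z)"

definition lawvere_isometric_embedding ::
  "'o set \<Rightarrow> ('o \<Rightarrow> 'o \<Rightarrow> ennreal) \<Rightarrow> 'p set \<Rightarrow> ('p \<Rightarrow> 'p \<Rightarrow> ennreal) \<Rightarrow> ('o \<Rightarrow> 'p) \<Rightarrow> bool" where
  "lawvere_isometric_embedding S \<delta> T \<delta>' F \<longleftrightarrow>
     lawvere_metric_space S \<delta> \<and> lawvere_metric_space T \<delta>' \<and>
     (\<forall>x\<in>S. F x \<in> T) \<and>
     (\<forall>x\<in>S. \<forall>y\<in>S. \<delta>' (F x) (F y) = \<delta> x y)"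

section \<open>Multivalued maps and correspondences\<close>

definition multivalued_map :: "'a set \<Rightarrow> 'b set \<Rightarrow> ('a \<times> 'b) set \<Rightarrow> bool" where
  "multivalued_map X Y C \<longleftrightarrow> C \<subseteq> X \<times> Y \<and> Domain C = X"

definition correspondence :: "'a set \<Rightarrow> 'b set \<Rightarrow> ('a \<times> 'b) set \<Rightarrow> bool" where
  "correspondence X Y C \<longleftrightarrow> multivalued_map X Y C \<and> Range C = Y"

definition subordinate :: "'a set \<Rightarrow> 'b set \<Rightarrow> ('a \<times> 'b) set \<Rightarrow> ('a \<Rightarrow> 'b) \<Rightarrow> bool" where
  "subordinate X Y C f \<longleftrightarrow> f \<in> X \<rightarrow> Y \<and> (\<forall>x\<in>X. (x, f x) \<in> C)"

section \<open>Metric spaces\<close>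

text \<open>
  The functions \<open>mdist M\<close> are total; \<open>Obj Met\<close> contains the unique representative of each metric
  space on a subset of the type \<open>'a\<close> whose distance function is 0 off the carrier.
\<close>

definition lipschitz1_maps :: "'a metric \<Rightarrow> 'b metric \<Rightarrow> ('a \<Rightarrow> 'b) set" where
  "lipschitz1_maps M N = {f \<in> mspace M \<rightarrow>\<^sub>E mspace N.
     \<forall>x\<in>mspace M. \<forall>x'\<in>mspace M. mdist N (f x) (f x') \<le> mdist M x x'}"

definition Met :: "('a metric, 'a \<Rightarrow> 'a) category" where
  "Met = \<lparr>
     Obj = {M. \<forall>x y. x \<notin> mspace M \<or> y \<notin> mspace M \<longrightarrow> mdist M x y = 0},
     Hom = lipschitz1_maps,
     Ident = (\<lambda>M. \<lambda>x\<in>mspace M. x),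
     Comp = (\<lambda>M. compose (mspace M)) \<rparr>"

definition metric_multivalued_map ::
  "real \<Rightarrow> 'a metric \<Rightarrow> 'b metric \<Rightarrow> ('a \<times> 'b) set \<Rightarrow> bool" where
  "metric_multivalued_map \<epsilon> M N C \<longleftrightarrow>
     multivalued_map (mspace M) (mspace N) C \<and>
     (\<forall>x y x' y'. (x, y) \<in> C \<and> (x', y') \<in> C \<longrightarrow> mdist N y y' \<le> mdist M x x' + \<epsilon>)"

definition metric_correspondence ::
  "real \<Rightarrow> 'a metric \<Rightarrow> 'b metric \<Rightarrow> ('a \<times> 'b) set \<Rightarrow> bool" where
  "metric_correspondence \<epsilon> M N C \<longleftrightarrow>
     correspondence (mspace M) (mspace N) C \<and>
     metric_multivalued_map \<epsilon> M N C \<and> metric_multivalued_map \<epsilon> N M (C\<inverse>)"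

definition metric_distortion :: "'a metric \<Rightarrow> 'b metric \<Rightarrow> ('a \<times> 'b) set \<Rightarrow> ennreal" where
  "metric_distortion M N C = (INF \<epsilon>\<in>{\<epsilon>. 0 \<le> \<epsilon> \<and> metric_correspondence \<epsilon> M N C}. ennreal \<epsilon>)"

definition GH_metric :: "'a metric \<Rightarrow> 'b metric \<Rightarrow> ennreal" where
  "GH_metric M N = (INF C\<in>{C. correspondence (mspace M) (mspace N) C}. metric_distortion M N C) / 2"

section \<open>Closure spaces\<close>

definition closure_space :: "'a set \<Rightarrow> ('a set \<Rightarrow> 'a set) \<Rightarrow> bool" where
  "closure_space X c \<longleftrightarrow>
     c \<in> Pow X \<rightarrow>\<^sub>E Pow X \<and>
     c {} = {} \<and>
     (\<forall>A\<subseteq>X. A \<subseteq> c A) \<and>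
     (\<forall>A\<subseteq>X. \<forall>B\<subseteq>X. c (A \<union> B) = c A \<union> c B)"

definition closure_maps ::
  "'a set \<Rightarrow> ('a set \<Rightarrow> 'a set) \<Rightarrow> 'b set \<Rightarrow> ('b set \<Rightarrow> 'b set) \<Rightarrow> ('a \<Rightarrow> 'b) set" where
  "closure_maps X c Y c' = {f \<in> X \<rightarrow>\<^sub>E Y. \<forall>A\<subseteq>X. f ` c A \<subseteq> c' (f ` A)}"

section \<open>Filtrations of closure spaces\<close>

record 'a filtration =
  level :: "real \<Rightarrow> 'a set"
  clos :: "real \<Rightarrow> 'a set \<Rightarrow> 'a set"
  tmap :: "real \<Rightarrow> real \<Rightarrow> 'a \<Rightarrow> 'a"

text \<open>
  The value of \<open>tmap F s t\<close> for \<open>t < s\<close> is irrelevant and normalised to \<open>undefined\<close>, so that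
  equality in HOL is equality of functors.
\<close>

definition is_filtration :: "'a filtration \<Rightarrow> bool" where
  "is_filtration F \<longleftrightarrow>
     (\<forall>t. closure_space (level F t) (clos F t)) \<and>
     (\<forall>s t. s \<le> t \<longrightarrow>
        tmap F s t \<in> closure_maps (level F s) (clos F s) (level F t) (clos F t) \<and>
        inj_on (tmap F s t) (level F s)) \<and>
     (\<forall>t. \<forall>x\<in>level F t. tmap F t t x = x) \<and>
     (\<forall>r s t. r \<le> s \<and> s \<le> t \<longrightarrow> (\<forall>x\<in>level F r. tmap F s t (tmap F r s x) = tmap F r t x)) \<and>
     (\<forall>s t. t < s \<longrightarrow> tmap F s t = undefined)"

definition filtration_maps :: "'a filtration \<Rightarrow> 'b filtration \<Rightarrow> (real \<Rightarrow> 'a \<Rightarrow> 'b) set" where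
  "filtration_maps F G = {\<eta>.
     (\<forall>t. \<eta> t \<in> closure_maps (level F t) (clos F t) (level G t) (clos G t)) \<and>
     (\<forall>s t. s \<le> t \<longrightarrow> (\<forall>x\<in>level F s. \<eta> t (tmap F s t x) = tmap G s t (\<eta> s x)))}"

definition filtration_id :: "'a filtration \<Rightarrow> real \<Rightarrow> 'a \<Rightarrow> 'a" where
  "filtration_id F = (\<lambda>t. \<lambda>x\<in>level F t. x)"

definition filtration_comp ::
  "'a filtration \<Rightarrow> (real \<Rightarrow> 'b \<Rightarrow> 'c) \<Rightarrow> (real \<Rightarrow> 'a \<Rightarrow> 'b) \<Rightarrow> real \<Rightarrow> 'a \<Rightarrow> 'c" where
  "filtration_comp F \<theta> \<eta> = (\<lambda>t. compose (level F t) (\<theta> t) (\<eta> t))"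

definition FRCl :: "('a filtration, real \<Rightarrow> 'a \<Rightarrow> 'a) category" where
  "FRCl = \<lparr>
     Obj = {F. is_filtration F},
     Hom = filtration_maps,
     Ident = filtration_id,
     Comp = filtration_comp \<rparr>"

definition filtration_iso :: "'a filtration \<Rightarrow> 'b filtration \<Rightarrow> bool" where
  "filtration_iso F G \<longleftrightarrow>
     (\<exists>\<eta>\<in>filtration_maps F G. \<exists>\<theta>\<in>filtration_maps G F.
        filtration_comp F \<theta> \<eta> = filtration_id F \<and> filtration_comp G \<eta> \<theta> = filtration_id G)"

definition filtered_closure_space :: "'a filtration \<Rightarrow> bool" where
  "filtered_closure_space F \<longleftrightarrow>
     is_filtration F \<and> (\<forall>s t. s \<le> t \<longrightarrow> (\<forall>x\<in>level F s. tmap F s t x = x))"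

definition total_space :: "'a filtration \<Rightarrow> 'a set" where
  "total_space F = (\<Union>t. level F t)"

section \<open>Gromov-Hausdorff distance of filtrations\<close>

definition filtered_multivalued_map ::
  "real \<Rightarrow> 'a filtration \<Rightarrow> 'b filtration \<Rightarrow> ('a \<times> 'b) set \<Rightarrow> bool" where
  "filtered_multivalued_map \<epsilon> F G C \<longleftrightarrow>
     multivalued_map (total_space F) (total_space G) C \<and>
     (\<forall>t. (\<forall>x y. x \<in> level F t \<and> (x, y) \<in> C \<longrightarrow> y \<in> level G (t + \<epsilon>)) \<and>
          (\<forall>A f. A \<subseteq> level F t \<and> subordinate (total_space F) (total_space G) C f \<longrightarrow>
             C `` clos F t A \<subseteq> clos G (t + \<epsilon>) (f ` A)))"

definition filtered_correspondence ::
  "real \<Rightarrow> 'a filtration \<Rightarrow> 'b filtration \<Rightarrow> ('a \<times> 'b) set \<Rightarrow> bool" where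
  "filtered_correspondence \<epsilon> F G C \<longleftrightarrow>
     correspondence (total_space F) (total_space G) C \<and>
     filtered_multivalued_map \<epsilon> F G C \<and> filtered_multivalued_map \<epsilon> G F (C\<inverse>)"

definition filtered_distortion :: "'a filtration \<Rightarrow> 'b filtration \<Rightarrow> ('a \<times> 'b) set \<Rightarrow> ennreal" where
  "filtered_distortion F G C = (INF \<epsilon>\<in>{\<epsilon>. 0 \<le> \<epsilon> \<and> filtered_correspondence \<epsilon> F G C}. ennreal \<epsilon>)"

definition GH_filtered :: "'a filtration \<Rightarrow> 'b filtration \<Rightarrow> ennreal" where
  "GH_filtered F G =
     (INF C\<in>{C. correspondence (total_space F) (total_space G) C}. filtered_distortion F G C) / 2"

text \<open>
  Every filtration is isomorphic to a filtered closure space whose total space is its colimit.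
  The points of the colimit are equivalence classes of pairs \<open>(t, x)\<close> with \<open>x \<in> level F t\<close>, so
  there is always a replacement with points in \<open>(real \<times> 'a) set\<close>.
\<close>

lemma filtered_replacement_exists:
  fixes F :: "'a filtration"
  assumes "is_filtration F"
  shows "\<exists>F' :: (real \<times> 'a) set filtration. filtered_closure_space F' \<and> filtration_iso F F'"
proof -
  have cs: "closure_space (level F t) (clos F t)" for t
    using assms by (simp add: is_filtration_def)
  have mp: "tmap F s t \<in> closure_maps (level F s) (clos F s) (level F t) (clos F t)"
    and mono: "inj_on (tmap F s t) (level F s)" if "s \<le> t" for s t
    using assms that by (simp_all add: is_filtration_def)
  have fid: "tmap F t t x = x" if "x \<in> level F t" for t x
    using assms that by (simp add: is_filtration_def)
  have comp: "tmap F s t (tmap F r s x) = tmap F r t x"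
    if "r \<le> s" "s \<le> t" "x \<in> level F r" for r s t x
    using assms that unfolding is_filtration_def by blast
  have mem: "tmap F s t x \<in> level F t" if "s \<le> t" "x \<in> level F s" for s t x
    using mp[OF that(1)] that(2) by (auto simp: closure_maps_def)
  have sub: "clos F t A \<subseteq> level F t" if "A \<subseteq> level F t" for t A
    using cs[of t] that unfolding closure_space_def PiE_def by auto
  have cont: "tmap F s t ` clos F s A \<subseteq> clos F t (tmap F s t ` A)"
    if "s \<le> t" "A \<subseteq> level F s" for s t A
    using mp[OF that(1)] that(2) by (auto simp: closure_maps_def)

  define k where "k t x = {(s, y). y \<in> level F s \<and> (\<exists>u. s \<le> u \<and> t \<le> u \<and> tmap F s u y = tmap F t u x)}"
    for t x
  have k_inj: "inj_on (k t) (level F t)" for t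
  proof (rule inj_onI)
    fix x x' assume x: "x \<in> level F t" "x' \<in> level F t" and eq: "k t x = k t x'"
    have "(t, x) \<in> k t x" using x by (auto simp: k_def)
    with eq have "(t, x) \<in> k t x'" by simp
    then obtain u where "t \<le> u" "tmap F t u x = tmap F t u x'" by (auto simp: k_def)
    with mono x show "x = x'" by (auto dest: inj_onD)
  qed
  have k_tmap: "k t (tmap F s t x) = k s x" if st: "s \<le> t" and x: "x \<in> level F s" for s t x
  proof (intro set_eqI iffI)
    fix p assume "p \<in> k t (tmap F s t x)"
    then obtain r y u where p: "p = (r, y)" "y \<in> level F r" "r \<le> u" "t \<le> u"
      "tmap F r u y = tmap F t u (tmap F s t x)" by (auto simp: k_def)
    then show "p \<in> k s x" using comp[OF st p(4) x] st by (auto simp: k_def intro!: exI[of _ u])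
  next
    fix p assume "p \<in> k s x"
    then obtain r y u where p: "p = (r, y)" "y \<in> level F r" "r \<le> u" "s \<le> u"
      "tmap F r u y = tmap F s u x" by (auto simp: k_def)
    let ?v = "max u t"
    have "tmap F r ?v y = tmap F u ?v (tmap F r u y)" using comp[of r u ?v y] p by simp
    also have "\<dots> = tmap F s ?v x" using comp[of s u ?v x] p x by simp
    also have "\<dots> = tmap F t ?v (tmap F s t x)" using comp[of s t ?v x] st x by simp
    finally show "p \<in> k t (tmap F s t x)" using p by (auto simp: k_def intro!: exI[of _ ?v])
  qed
  define j where "j t = the_inv_into (level F t) (k t)" for t
  define X where "X t = k t ` level F t" for t
  have jk: "j t (k t x) = x" if "x \<in> level F t" for t x
    using that k_inj by (simp add: j_def the_inv_into_f_f)
  have kj: "k t (j t p) = p" if "p \<in> X t" for t p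
    using that by (auto simp: X_def jk)
  have jX: "j t p \<in> level F t" if "p \<in> X t" for t p
    using that by (auto simp: X_def jk)
  have jkA: "j t ` k t ` A = A" if "A \<subseteq> level F t" for t A
    using that jk by (force simp: image_image)
  have kjA: "k t ` j t ` A = A" if "A \<subseteq> X t" for t A
    using that kj by (force simp: image_image)
  have XX: "X s \<subseteq> X t" if st: "s \<le> t" for s t
  proof
    fix p assume "p \<in> X s"
    then obtain x where "x \<in> level F s" "p = k s x" by (auto simp: X_def)
    then have "p = k t (tmap F s t x)" "tmap F s t x \<in> level F t"
      using k_tmap[OF st] mem[OF st] by simp_all
    then show "p \<in> X t" by (simp add: X_def)
  qed
  have jtm: "j t p = tmap F s t (j s p)" if st: "s \<le> t" and p: "p \<in> X s" for s t p
  proof -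
    from p obtain x where x: "x \<in> level F s" "p = k s x" by (auto simp: X_def)
    have "j t p = j t (k t (tmap F s t x))" using x k_tmap[OF st] by simp
    also have "\<dots> = tmap F s t x" using jk mem[OF st] x by simp
    finally show ?thesis using x jk by simp
  qed
  define c where "c t = (\<lambda>A\<in>Pow (X t). k t ` clos F t (j t ` A))" for t
  have c_eq: "c t A = k t ` clos F t (j t ` A)" if "A \<subseteq> X t" for t A
    using that by (simp add: c_def)
  have jA: "j t ` A \<subseteq> level F t" if "A \<subseteq> X t" for t A
    using that jX by auto
  have ccs: "closure_space (X t) (c t)" for t
    unfolding closure_space_def
  proof (intro conjI allI impI)
    show "c t \<in> Pow (X t) \<rightarrow>\<^sub>E Pow (X t)"
    proof (rule PiE_I)
      fix A assume "A \<in> Pow (X t)"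
      then show "c t A \<in> Pow (X t)"
        using sub[OF jA[of A t]] by (auto simp: c_eq X_def)
    qed (simp add: c_def)
    show "c t {} = {}" using cs[of t] by (simp add: c_eq closure_space_def)
    fix A assume A: "A \<subseteq> X t"
    have "j t ` A \<subseteq> clos F t (j t ` A)" using cs[of t] jA[OF A] by (simp add: closure_space_def)
    then have "k t ` j t ` A \<subseteq> c t A" using A by (auto simp: c_eq)
    then show "A \<subseteq> c t A" using kjA[OF A] by simp
    fix B assume B: "B \<subseteq> X t"
    have "clos F t (j t ` A \<union> j t ` B) = clos F t (j t ` A) \<union> clos F t (j t ` B)"
      using cs[of t] jA[OF A] jA[OF B] by (simp add: closure_space_def)
    then show "c t (A \<union> B) = c t A \<union> c t B"
      using A B by (simp add: c_eq image_Un)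
  qed
  have k_cm: "restrict (k t) (level F t) \<in> closure_maps (level F t) (clos F t) (X t) (c t)" for t
    unfolding closure_maps_def
  proof (intro CollectI conjI allI impI)
    fix A assume A: "A \<subseteq> level F t"
    have "restrict (k t) (level F t) ` clos F t A = k t ` clos F t A"
      using sub[OF A] by auto
    moreover have "restrict (k t) (level F t) ` A = k t ` A" using A by auto
    moreover have "k t ` A \<subseteq> X t" using A by (auto simp: X_def)
    ultimately show "restrict (k t) (level F t) ` clos F t A \<subseteq> c t (restrict (k t) (level F t) ` A)"
      using A by (simp add: c_eq jkA)
  qed (auto simp: X_def)
  have j_cm: "restrict (j t) (X t) \<in> closure_maps (X t) (c t) (level F t) (clos F t)" for t
    unfolding closure_maps_def
  proof (intro CollectI conjI allI impI)
    fix A assume A: "A \<subseteq> X t"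
    have "c t A \<subseteq> X t" using sub[OF jA[OF A]] A by (auto simp: c_eq X_def)
    then have "restrict (j t) (X t) ` c t A = j t ` c t A" by auto
    moreover have "restrict (j t) (X t) ` A = j t ` A" using A by auto
    ultimately show "restrict (j t) (X t) ` c t A \<subseteq> clos F t (restrict (j t) (X t) ` A)"
      using A by (simp add: c_eq jkA sub jA)
  qed (auto simp: jX)
  define F' where "F' = \<lparr>level = X, clos = c,
      tmap = (\<lambda>s t. if s \<le> t then \<lambda>x\<in>X s. x else undefined)\<rparr>"
  have i_cm: "(\<lambda>x\<in>X s. x) \<in> closure_maps (X s) (c s) (X t) (c t)" if st: "s \<le> t" for s t
    unfolding closure_maps_def
  proof (intro CollectI conjI allI impI)
    show "(\<lambda>x\<in>X s. x) \<in> X s \<rightarrow>\<^sub>E X t" using XX[OF st] by auto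
    fix A assume A: "A \<subseteq> X s"
    have cA: "c s A \<subseteq> X s" using sub[OF jA[OF A]] A by (auto simp: c_eq X_def)
    have At: "A \<subseteq> X t" using A XX[OF st] by auto
    have "(\<lambda>x\<in>X s. x) ` c s A = c s A" using cA by force
    also have "\<dots> = k s ` clos F s (j s ` A)" using A by (rule c_eq)
    also have "\<dots> = k t ` tmap F s t ` clos F s (j s ` A)"
      unfolding image_image
      by (rule image_cong[OF refl]) (use k_tmap[OF st] sub[OF jA[OF A]] in \<open>simp add: subset_iff\<close>)
    also have "\<dots> \<subseteq> k t ` clos F t (tmap F s t ` j s ` A)"
      using cont[OF st jA[OF A]] by (rule image_mono)
    also have "tmap F s t ` j s ` A = j t ` A"
      unfolding image_image
      by (rule image_cong[OF refl]) (use jtm[OF st] A in \<open>simp add: subset_iff\<close>)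
    also have "k t ` clos F t (j t ` A) = c t A" using At by (simp add: c_eq)
    also have "c t A = c t ((\<lambda>x\<in>X s. x) ` A)" by (rule arg_cong[of _ _ "c t"]) (use A in force)
    finally show "(\<lambda>x\<in>X s. x) ` c s A \<subseteq> c t ((\<lambda>x\<in>X s. x) ` A)" .
  qed
  have "filtered_closure_space F'"
    unfolding filtered_closure_space_def is_filtration_def F'_def
    using ccs i_cm XX by (auto simp: inj_on_def subset_iff)
  moreover have "filtration_iso F F'"
    unfolding filtration_iso_def
  proof (intro bexI conjI)
    let ?e = "\<lambda>t. restrict (k t) (level F t)" and ?h = "\<lambda>t. restrict (j t) (X t)"
    show "?e \<in> filtration_maps F F'"
      using k_cm k_tmap mem by (auto simp: filtration_maps_def F'_def X_def)
    show "?h \<in> filtration_maps F' F"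
      using j_cm jtm XX by (auto simp: filtration_maps_def F'_def subset_iff)
    show "filtration_comp F ?h ?e = filtration_id F"
      by (auto simp: filtration_comp_def filtration_id_def compose_def fun_eq_iff jk X_def)
    show "filtration_comp F' ?e ?h = filtration_id F'"
      by (auto simp: filtration_comp_def filtration_id_def compose_def fun_eq_iff F'_def kj jX)
  qed
  ultimately show ?thesis by blast
qed

definition filtered_replacement :: "'a filtration \<Rightarrow> (real \<times> 'a) set filtration" where
  "filtered_replacement F = (SOME F'. filtered_closure_space F' \<and> filtration_iso F F')"

definition GH_filtration :: "'a filtration \<Rightarrow> 'b filtration \<Rightarrow> ennreal" where
  "GH_filtration F G = GH_filtered (filtered_replacement F) (filtered_replacement G)"

section \<open>The filtration associated with a metric space\<close>

definition met_filtration :: "'a metric \<Rightarrow> 'a filtration" where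
  "met_filtration M =
     (let X = (\<lambda>t::real. if t < 0 then {} else mspace M) in
      \<lparr> level = X,
        clos = (\<lambda>t. \<lambda>A\<in>Pow (X t). {x \<in> X t. \<exists>a\<in>A. mdist M a x \<le> t}),
        tmap = (\<lambda>s t. if s \<le> t then \<lambda>x\<in>X s. x else undefined) \<rparr>)"

definition met_filtration_map :: "'a metric \<Rightarrow> 'b metric \<Rightarrow> ('a \<Rightarrow> 'b) \<Rightarrow> real \<Rightarrow> 'a \<Rightarrow> 'b" where
  "met_filtration_map M N f = (\<lambda>t. restrict f (level (met_filtration M) t))"

end

theory Submission
  imports Defs
begin

text \<open>
  For \<open>\<epsilon> \<ge> 0\<close> the \<open>\<epsilon>\<close>-correspondences between metric spaces and between their filtrations are the
  same: if \<open>x C y\<close>, \<open>x' C y'\<close> and \<open>t = d(x, x')\<close>, then \<open>x'\<close> lies in the \<open>t\<close>-closure of \<open>{x}\<close>, and a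
  function subordinate to \<open>C\<close> that sends \<open>x\<close> to \<open>y\<close> turns the closure condition into
  \<open>e(y, y') \<le> t + \<epsilon>\<close>. The same test on singletons recovers the metric and the 1-Lipschitz maps from
  the filtrations. The choice of a replacement does not matter, since an isomorphism of filtered
  closure spaces is a 0-correspondence and the distance satisfies the triangle inequality.
\<close>

section \<open>Infima in the extended half-line\<close>

text \<open>Truncated subtraction is adjoint to adding a finite \<open>b\<close>, so the bounds
  \<open>a - b \<le> f i\<close> pass to the infimum. The adjunction fails at
  \<open>b = top\<close>, where \<open>top - top = top\<close>, but there the claim is
  trivial.\<close>

lemma le_add_INF_ennreal:
  fixes f :: "'i \<Rightarrow> ennreal"
  assumes "\<And>i. i \<in> I \<Longrightarrow> a \<le> b + f i"
  shows "a \<le> b + (INF i\<in>I. f i)"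
proof (cases "b = top")
  case False
  have "a - b \<le> (INF i\<in>I. f i)"
    using assms False by (intro INF_greatest) (simp add: ennreal_minus_le_iff)
  then show ?thesis
    by (simp add: ennreal_minus_le_iff)
qed simp

lemma le_INF_add_INF_ennreal:
  fixes f :: "'i \<Rightarrow> ennreal"
  assumes "\<And>i j. i \<in> I \<Longrightarrow> j \<in> J \<Longrightarrow> a \<le> f i + g j"
  shows "a \<le> (INF i\<in>I. f i) + (INF j\<in>J. g j)"
proof (rule le_add_INF_ennreal)
  fix j assume j: "j \<in> J"
  have "a \<le> g j + (INF i\<in>I. f i)"
    using assms j by (intro le_add_INF_ennreal) (simp add: add.commute)
  then show "a \<le> (INF i\<in>I. f i) + g j"
    by (simp add: add.commute)
qed

text \<open>With \<open>P\<close> for being a correspondence and \<open>Q\<close> for the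
  \<open>\<epsilon>\<close>-condition, the double infimum is twice a Gromov-Hausdorff distance. The
  abstract form serves metric spaces and filtrations alike.\<close>

lemma INF_distortion_le:
  assumes "P C" and "Q \<epsilon> C" and "0 \<le> \<epsilon>"
  shows "(INF C\<in>{C. P C}. INF \<epsilon>\<in>{\<epsilon>::real. 0 \<le> \<epsilon> \<and> Q \<epsilon> C}. ennreal \<epsilon>) \<le> ennreal \<epsilon>"
  using assms by (intro INF_lower2[of C] INF_lower) auto

text \<open>Composing relations adds their bounds. The left side is compared with every sum
  \<open>\<epsilon> + \<delta>\<close>, so neither attained infima nor near-minimisers are
  required.\<close>

lemma INF_distortion_triangle:
  assumes "\<And>\<epsilon> \<delta> C D. 0 \<le> \<epsilon> \<Longrightarrow> 0 \<le> \<delta> \<Longrightarrow> Q \<epsilon> C \<Longrightarrow> Q' \<delta> D \<Longrightarrow> Q'' (\<epsilon> + \<delta>) (C O D)"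
    and "\<And>\<epsilon> C. Q'' \<epsilon> C \<Longrightarrow> P'' C"
  shows "(INF C\<in>{C. P'' C}. INF \<epsilon>\<in>{\<epsilon>::real. 0 \<le> \<epsilon> \<and> Q'' \<epsilon> C}. ennreal \<epsilon>)
    \<le> (INF C\<in>{C. P C}. INF \<epsilon>\<in>{\<epsilon>::real. 0 \<le> \<epsilon> \<and> Q \<epsilon> C}. ennreal \<epsilon>)
      + (INF C\<in>{C. P' C}. INF \<epsilon>\<in>{\<epsilon>::real. 0 \<le> \<epsilon> \<and> Q' \<epsilon> C}. ennreal \<epsilon>)"
proof (intro le_INF_add_INF_ennreal)
  fix C D and \<epsilon> \<delta> :: real
  assume e: "\<epsilon> \<in> {\<epsilon>. 0 \<le> \<epsilon> \<and> Q \<epsilon> C}" "\<delta> \<in> {\<delta>. 0 \<le> \<delta> \<and> Q' \<delta> D}"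
  have Q: "Q'' (\<epsilon> + \<delta>) (C O D)"
    using e assms(1) by blast
  have "(INF C\<in>{C. P'' C}. INF \<epsilon>\<in>{\<epsilon>::real. 0 \<le> \<epsilon> \<and> Q'' \<epsilon> C}. ennreal \<epsilon>) \<le> ennreal (\<epsilon> + \<delta>)"
    using e by (intro INF_distortion_le[where C = "C O D"] Q assms(2)[OF Q]) simp_all
  then show "(INF C\<in>{C. P'' C}. INF \<epsilon>\<in>{\<epsilon>::real. 0 \<le> \<epsilon> \<and> Q'' \<epsilon> C}. ennreal \<epsilon>)
      \<le> ennreal \<epsilon> + ennreal \<delta>"
    using e by simp
qed

section \<open>Composition of correspondences\<close>

lemma multivalued_map_relcomp:
  assumes "multivalued_map X Y C" and "multivalued_map Y Z D"
  shows "multivalued_map X Z (C O D)"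
  using assms unfolding multivalued_map_def by blast

lemma correspondence_relcomp:
  assumes "correspondence X Y C" and "correspondence Y Z D"
  shows "correspondence X Z (C O D)"
  using assms unfolding correspondence_def multivalued_map_def by blast

lemma multivalued_map_Id_on: "multivalued_map X X (Id_on X)"
  by (auto simp: multivalued_map_def)

section \<open>Metric correspondences and the triangle inequality for
  \<open>GH_metric\<close>\<close>

lemma metric_multivalued_map_relcomp:
  assumes "metric_multivalued_map \<epsilon> M N C" and "metric_multivalued_map \<delta> N K D"
  shows "metric_multivalued_map (\<epsilon> + \<delta>) M K (C O D)"
  unfolding metric_multivalued_map_def
proof (intro conjI allI impI)
  show "multivalued_map (mspace M) (mspace K) (C O D)"
    using assms unfolding metric_multivalued_map_def by (blast intro: multivalued_map_relcomp)
  fix x z x' z' assume "(x, z) \<in> C O D \<and> (x', z') \<in> C O D"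
  then obtain y y' where "(x, y) \<in> C" "(y, z) \<in> D" "(x', y') \<in> C" "(y', z') \<in> D"
    by blast
  then have "mdist N y y' \<le> mdist M x x' + \<epsilon>" "mdist K z z' \<le> mdist N y y' + \<delta>"
    using assms unfolding metric_multivalued_map_def by blast+
  then show "mdist K z z' \<le> mdist M x x' + (\<epsilon> + \<delta>)"
    by simp
qed

lemma metric_correspondenceD:
  "metric_correspondence \<epsilon> M N C \<Longrightarrow> correspondence (mspace M) (mspace N) C"
  by (simp add: metric_correspondence_def)

lemma metric_correspondence_relcomp:
  assumes "metric_correspondence \<epsilon> M N C" and "metric_correspondence \<delta> N K D"
  shows "metric_correspondence (\<epsilon> + \<delta>) M K (C O D)"
  using assms correspondence_relcomp metric_multivalued_map_relcomp[of \<epsilon> M N C \<delta> K D]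
    metric_multivalued_map_relcomp[of \<delta> K N "D\<inverse>" \<epsilon> M "C\<inverse>"]
  unfolding metric_correspondence_def by (auto simp: converse_relcomp add.commute)

lemma metric_correspondence_Id_on: "metric_correspondence 0 M M (Id_on (mspace M))"
  using multivalued_map_Id_on[of "mspace M"]
  by (auto simp: metric_correspondence_def metric_multivalued_map_def correspondence_def)

lemma GH_metric_triangle: "GH_metric M K \<le> GH_metric M N + GH_metric N K"
  unfolding GH_metric_def metric_distortion_def add_divide_distrib_ennreal[symmetric]
  by (intro divide_right_mono_ennreal INF_distortion_triangle)
    (auto intro: metric_correspondence_relcomp metric_correspondenceD)

lemma GH_metric_self: "GH_metric M M = 0"
proof -
  have "GH_metric M M \<le> ennreal 0 / 2"
    unfolding GH_metric_def metric_distortion_def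
    by (intro divide_right_mono_ennreal INF_distortion_le[of _ "Id_on (mspace M)"])
      (use metric_correspondence_Id_on[of M] in \<open>auto simp: metric_correspondence_def\<close>)
  then show ?thesis by simp
qed

section \<open>Filtered correspondences and the triangle inequality for
  \<open>GH_filtered\<close>\<close>

lemma closure_space_mono:
  assumes "closure_space X c" and "A \<subseteq> B" and "B \<subseteq> X"
  shows "c A \<subseteq> c B"
proof -
  have "\<forall>A\<subseteq>X. \<forall>B\<subseteq>X. c (A \<union> B) = c A \<union> c B"
    using assms(1) by (simp add: closure_space_def)
  then have "c (A \<union> B) = c A \<union> c B"
    using assms(2,3) order_trans by meson
  \<comment> \<open>Monotonicity is not an axiom of closure spaces; additivity yields it through
    this identity.\<close>
  moreover have "A \<union> B = B"
    using assms(2) by blast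
  ultimately show ?thesis by auto
qed

lemma closure_space_subset:
  assumes "closure_space X c" and "A \<subseteq> X"
  shows "c A \<subseteq> X"
  using assms unfolding closure_space_def PiE_def by auto

text \<open>A function subordinate to \<open>C O D\<close> is traced through intermediate points:
  \<open>g\<close> follows \<open>C\<close>, a suitable \<open>h\<close> follows \<open>D\<close>,
  and the two closure conditions are chained. The closure axioms of the target \<open>H\<close>
  supply monotonicity for the last inclusion.\<close>

lemma filtered_multivalued_map_relcomp:
  assumes C: "filtered_multivalued_map \<epsilon> F G C" and D: "filtered_multivalued_map \<delta> G H D"
    and H: "\<And>t. closure_space (level H t) (clos H t)"
  shows "filtered_multivalued_map (\<epsilon> + \<delta>) F H (C O D)"
proof -
  have mC: "multivalued_map (total_space F) (total_space G) C"
    and mD: "multivalued_map (total_space G) (total_space H) D"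
    using C D by (simp_all add: filtered_multivalued_map_def)
  have lC: "y \<in> level G (t + \<epsilon>)" if "x \<in> level F t" "(x, y) \<in> C" for x y t
    using C that unfolding filtered_multivalued_map_def by blast
  have lD: "y \<in> level H (t + \<delta>)" if "x \<in> level G t" "(x, y) \<in> D" for x y t
    using D that unfolding filtered_multivalued_map_def by blast
  have "(C O D) `` clos F t A \<subseteq> clos H (t + (\<epsilon> + \<delta>)) (f ` A)"
    if A: "A \<subseteq> level F t" and f: "subordinate (total_space F) (total_space H) (C O D) f" for t A f
  proof -
    have "\<forall>x\<in>total_space F. \<exists>y. (x, y) \<in> C \<and> (y, f x) \<in> D"
      using f unfolding subordinate_def by blast
    then obtain g where g: "\<And>x. x \<in> total_space F \<Longrightarrow> (x, g x) \<in> C \<and> (g x, f x) \<in> D"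
      by metis
    have AF: "A \<subseteq> total_space F"
      using A by (auto simp: total_space_def)
    \<comment> \<open>\<open>f\<close> need not factor as \<open>h \<circ> g\<close>, because \<open>g\<close> may identify points that \<open>f\<close> separates;
      \<open>h (g ` A) \<subseteq> f ` A\<close> suffices by monotonicity of the closure.\<close>
    have "\<forall>y\<in>total_space G. \<exists>z. (y, z) \<in> D \<and> (y \<in> g ` A \<longrightarrow> z \<in> f ` A)"
    proof
      fix y assume y: "y \<in> total_space G"
      show "\<exists>z. (y, z) \<in> D \<and> (y \<in> g ` A \<longrightarrow> z \<in> f ` A)"
      proof (cases "y \<in> g ` A")
        case True
        then show ?thesis using g AF by blast
      next
        case False
        then show ?thesis using y mD unfolding multivalued_map_def by blast
      qed
    qed
    then obtain h where h: "\<And>y. y \<in> total_space G \<Longrightarrow> (y, h y) \<in> D"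
      "\<And>y. y \<in> total_space G \<Longrightarrow> y \<in> g ` A \<Longrightarrow> h y \<in> f ` A"
      by metis
    have sg: "subordinate (total_space F) (total_space G) C g"
      using g mC by (auto simp: subordinate_def multivalued_map_def)
    have sh: "subordinate (total_space G) (total_space H) D h"
      using h(1) mD by (auto simp: subordinate_def multivalued_map_def)
    have gA: "g ` A \<subseteq> level G (t + \<epsilon>)"
      using g AF A lC by blast
    have fA: "f ` A \<subseteq> level H (t + \<epsilon> + \<delta>)"
      using g AF gA lD by blast
    have "(C O D) `` clos F t A \<subseteq> D `` clos G (t + \<epsilon>) (g ` A)"
      using C A sg unfolding filtered_multivalued_map_def relcomp_Image by blast
    also have "\<dots> \<subseteq> clos H (t + \<epsilon> + \<delta>) (h ` g ` A)"
      using D gA sh unfolding filtered_multivalued_map_def by blast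
    also have "\<dots> \<subseteq> clos H (t + \<epsilon> + \<delta>) (f ` A)"
      using h(2) gA by (intro closure_space_mono[OF H] fA) (force simp: total_space_def)
    finally show ?thesis
      by (simp add: add.assoc)
  qed
  moreover have "z \<in> level H (t + (\<epsilon> + \<delta>))" if "x \<in> level F t" "(x, z) \<in> C O D" for x z t
    using that lC lD[of _ "t + \<epsilon>"] unfolding add.assoc by blast
  ultimately show ?thesis
    using multivalued_map_relcomp[OF mC mD] unfolding filtered_multivalued_map_def by blast
qed

lemma filtered_correspondenceD:
  "filtered_correspondence \<epsilon> F G C \<Longrightarrow> correspondence (total_space F) (total_space G) C"
  by (simp add: filtered_correspondence_def)

text \<open>Both ends are filtrations because each is a target once: \<open>H\<close> for
  \<open>C O D\<close>, and \<open>F\<close> for its converse.\<close>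

lemma filtered_correspondence_relcomp:
  assumes "filtered_correspondence \<epsilon> F G C" and "filtered_correspondence \<delta> G H D"
    and "is_filtration F" and "is_filtration H"
  shows "filtered_correspondence (\<epsilon> + \<delta>) F H (C O D)"
  using assms correspondence_relcomp filtered_multivalued_map_relcomp[of \<epsilon> F G C \<delta> H D]
    filtered_multivalued_map_relcomp[of \<delta> H G "D\<inverse>" \<epsilon> F "C\<inverse>"]
  unfolding filtered_correspondence_def
  by (auto simp: converse_relcomp add.commute is_filtration_def)

lemma GH_filtered_triangle:
  assumes "is_filtration F" and "is_filtration H"
  shows "GH_filtered F H \<le> GH_filtered F G + GH_filtered G H"
  unfolding GH_filtered_def filtered_distortion_def add_divide_distrib_ennreal[symmetric]
  by (intro divide_right_mono_ennreal INF_distortion_triangle)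
    (auto intro: filtered_correspondence_relcomp filtered_correspondenceD assms)

lemma GH_filtered_eq_0:
  assumes "filtered_correspondence 0 F G C"
  shows "GH_filtered F G = 0"
proof -
  have "GH_filtered F G \<le> ennreal 0 / 2"
    unfolding GH_filtered_def filtered_distortion_def
    by (intro divide_right_mono_ennreal INF_distortion_le[of _ C])
      (use assms in \<open>auto simp: filtered_correspondence_def\<close>)
  then show ?thesis by simp
qed

section \<open>Invariance under isomorphism\<close>

lemma filtered_closure_space_level_mono:
  assumes "filtered_closure_space F" and "s \<le> t"
  shows "level F s \<subseteq> level F t"
proof
  fix x assume x: "x \<in> level F s"
  have "tmap F s t \<in> level F s \<rightarrow>\<^sub>E level F t"
    using assms unfolding filtered_closure_space_def is_filtration_def closure_maps_def by blast
  with x have "tmap F s t x \<in> level F t" by blast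
  moreover have "tmap F s t x = x"
    using assms x unfolding filtered_closure_space_def by blast
  ultimately show "x \<in> level F t" by simp
qed

text \<open>The components of \<open>\<eta>\<close> are glued into one relation between total
  spaces. For maps of filtered closure spaces it is single-valued, by
  \<open>filtration_map_level_indep\<close>.\<close>

definition filtration_map_graph :: "'a filtration \<Rightarrow> (real \<Rightarrow> 'a \<Rightarrow> 'b) \<Rightarrow> ('a \<times> 'b) set" where
  "filtration_map_graph F \<eta> = {(x, y). \<exists>t. x \<in> level F t \<and> y = \<eta> t x}"

text \<open>The transition maps are inclusions, so naturality says that each component restricts to
  the earlier ones.\<close>

lemma filtration_map_level_indep:
  assumes F: "filtered_closure_space F" and G: "filtered_closure_space G"
    and \<eta>: "\<eta> \<in> filtration_maps F G" and x: "x \<in> level F s" "x \<in> level F t"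
  shows "\<eta> s x = \<eta> t x"
proof -
  have "\<eta> s x = \<eta> t x" if st: "s \<le> t" and x: "x \<in> level F s" for s t
  proof -
    have "\<eta> s x \<in> level G s"
      using \<eta> x unfolding filtration_maps_def closure_maps_def by blast
    then have "tmap G s t (\<eta> s x) = \<eta> s x" "tmap F s t x = x"
      using F G st x unfolding filtered_closure_space_def by blast+
    moreover have "\<eta> t (tmap F s t x) = tmap G s t (\<eta> s x)"
      using \<eta> st x unfolding filtration_maps_def by blast
    ultimately show ?thesis by simp
  qed
  with x show ?thesis
    by (metis linear)
qed

text \<open>A function subordinate to the graph must agree with \<open>\<eta> t\<close> on level
  \<open>t\<close>, so the closure condition reduces to continuity of
  \<open>\<eta> t\<close>.\<close>

lemma filtered_multivalued_map_graph:
  assumes F: "filtered_closure_space F" and G: "filtered_closure_space G"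
    and \<eta>: "\<eta> \<in> filtration_maps F G"
  shows "filtered_multivalued_map 0 F G (filtration_map_graph F \<eta>)"
proof -
  let ?C = "filtration_map_graph F \<eta>"
  have cm: "\<eta> t \<in> closure_maps (level F t) (clos F t) (level G t) (clos G t)" for t
    using \<eta> by (simp add: filtration_maps_def)
  have mem: "\<eta> t x \<in> level G t" if "x \<in> level F t" for x t
    using cm that unfolding closure_maps_def by blast
  have val: "y = \<eta> t x" if "x \<in> level F t" "(x, y) \<in> ?C" for x y t
  proof -
    from that(2) obtain s where s: "x \<in> level F s" "y = \<eta> s x"
      by (auto simp: filtration_map_graph_def)
    show ?thesis
      using s(2) filtration_map_level_indep[OF F G \<eta> s(1) that(1)] by (rule trans)
  qed
  have "multivalued_map (total_space F) (total_space G) ?C"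
    using mem by (auto simp: multivalued_map_def total_space_def filtration_map_graph_def)
  moreover have "?C `` clos F t A \<subseteq> clos G t (f ` A)"
    if A: "A \<subseteq> level F t" and f: "subordinate (total_space F) (total_space G) ?C f" for t A f
  proof -
    have cs: "closure_space (level F t) (clos F t)"
      using F by (simp add: filtered_closure_space_def is_filtration_def)
    have "f a = \<eta> t a" if "a \<in> A" for a
      using f that A val by (auto simp: subordinate_def total_space_def)
    then have "f ` A = \<eta> t ` A" by simp
    moreover have "?C `` clos F t A \<subseteq> \<eta> t ` clos F t A"
      using closure_space_subset[OF cs A] val by blast
    moreover have "\<eta> t ` clos F t A \<subseteq> clos G t (\<eta> t ` A)"
      using cm A unfolding closure_maps_def by blast
    ultimately show ?thesis by simp
  qed
  moreover have "y \<in> level G t" if "x \<in> level F t" "(x, y) \<in> ?C" for t x y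
    using mem[OF that(1)] val[OF that] by simp
  ultimately show ?thesis
    unfolding filtered_multivalued_map_def add_0_right by blast
qed

lemma filtration_iso_sym: "filtration_iso F G \<Longrightarrow> filtration_iso G F"
  unfolding filtration_iso_def by blast

text \<open>Mutually inverse maps have converse graphs, so the graph of \<open>\<eta>\<close> is a
  0-correspondence.\<close>

lemma GH_filtered_iso:
  assumes F: "filtered_closure_space F" and G: "filtered_closure_space G" and "filtration_iso F G"
  shows "GH_filtered F G = 0"
proof -
  obtain \<eta> \<theta> where \<eta>: "\<eta> \<in> filtration_maps F G" and \<theta>: "\<theta> \<in> filtration_maps G F"
    and \<theta>\<eta>: "filtration_comp F \<theta> \<eta> = filtration_id F" and \<eta>\<theta>: "filtration_comp G \<eta> \<theta> = filtration_id G"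
    using assms(3) unfolding filtration_iso_def by blast
  have inv1: "\<theta> t (\<eta> t x) = x" if "x \<in> level F t" for t x
    using fun_cong[OF fun_cong[OF \<theta>\<eta>, of t], of x] that
    by (simp add: filtration_comp_def filtration_id_def compose_eq)
  have inv2: "\<eta> t (\<theta> t y) = y" if "y \<in> level G t" for t y
    using fun_cong[OF fun_cong[OF \<eta>\<theta>, of t], of y] that
    by (simp add: filtration_comp_def filtration_id_def compose_eq)
  have mem: "\<eta> t x \<in> level G t" if "x \<in> level F t" for x t
    using \<eta> that unfolding filtration_maps_def closure_maps_def by blast
  have mem': "\<theta> t y \<in> level F t" if "y \<in> level G t" for y t
    using \<theta> that unfolding filtration_maps_def closure_maps_def by blast
  have conv: "(filtration_map_graph F \<eta>)\<inverse> = filtration_map_graph G \<theta>"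
    unfolding filtration_map_graph_def using inv1 inv2 mem mem' by fastforce
  have m: "filtered_multivalued_map 0 F G (filtration_map_graph F \<eta>)"
    "filtered_multivalued_map 0 G F (filtration_map_graph G \<theta>)"
    by (intro filtered_multivalued_map_graph F G \<eta> \<theta>)+
  \<comment> \<open>Surjectivity of the graph of \<open>\<eta>\<close> is totality of the graph of
    \<open>\<theta>\<close>.\<close>
  moreover have "Range (filtration_map_graph F \<eta>) = Domain (filtration_map_graph G \<theta>)"
    by (simp flip: conv)
  ultimately have "filtered_correspondence 0 F G (filtration_map_graph F \<eta>)"
    using conv by (simp add: filtered_correspondence_def correspondence_def
        filtered_multivalued_map_def multivalued_map_def)
  then show ?thesis by (rule GH_filtered_eq_0)
qed

lemma filtration_id_in_filtration_maps:
  assumes "is_filtration F"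
  shows "filtration_id F \<in> filtration_maps F F"
proof -
  have cs: "closure_space (level F t) (clos F t)" for t
    using assms by (simp add: is_filtration_def)
  have mem: "tmap F s t x \<in> level F t" if "s \<le> t" "x \<in> level F s" for s t x
    using assms that unfolding is_filtration_def closure_maps_def by blast
  have im: "filtration_id F t ` A = A" if "A \<subseteq> level F t" for t A
    using that by (force simp: filtration_id_def)
  have "filtration_id F t \<in> closure_maps (level F t) (clos F t) (level F t) (clos F t)" for t
    using closure_space_subset[OF cs] im by (auto simp: closure_maps_def filtration_id_def)
  then show ?thesis
    using mem by (auto simp: filtration_maps_def filtration_id_def)
qed

lemma filtration_iso_refl:
  assumes "is_filtration F"
  shows "filtration_iso F F"
proof -
  have "filtration_comp F (filtration_id F) (filtration_id F) = filtration_id F"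
    by (auto simp: filtration_comp_def filtration_id_def compose_def fun_eq_iff)
  then show ?thesis
    using filtration_id_in_filtration_maps[OF assms] unfolding filtration_iso_def by blast
qed

section \<open>Independence of the chosen replacement\<close>

lemma filtered_replacement:
  assumes "is_filtration F"
  shows "filtered_closure_space (filtered_replacement F)" and "filtration_iso F (filtered_replacement F)"
  using someI_ex[OF filtered_replacement_exists[OF assms]] by (simp_all add: filtered_replacement_def)

lemma GH_filtration_self:
  assumes "is_filtration F"
  shows "GH_filtration F F = 0"
  using filtered_replacement[OF assms]
  by (simp add: GH_filtration_def GH_filtered_iso filtration_iso_refl filtered_closure_space_def)

lemma GH_filtration_triangle:
  assumes "is_filtration F" and "is_filtration H"
  shows "GH_filtration F H \<le> GH_filtration F G + GH_filtration G H"
  using filtered_replacement[OF assms(1)] filtered_replacement[OF assms(2)]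
  by (simp add: GH_filtration_def GH_filtered_triangle filtered_closure_space_def)

text \<open>The replacements have another point type, so the triangle inequality is applied across
  types: each direction inserts a space and its replacement twice, at distance zero.\<close>

lemma GH_filtration_eq_GH_filtered:
  assumes F: "filtered_closure_space F" and G: "filtered_closure_space G"
  shows "GH_filtration F G = GH_filtered F G"
proof -
  let ?F = "filtered_replacement F" and ?G = "filtered_replacement G"
  have f: "is_filtration F" "is_filtration G"
    using F G by (simp_all add: filtered_closure_space_def)
  note F' = filtered_replacement[OF f(1)] and G' = filtered_replacement[OF f(2)]
  have f': "is_filtration ?F" "is_filtration ?G"
    using F' G' by (simp_all add: filtered_closure_space_def)
  \<comment> \<open>\<open>filtration_iso_sym\<close> covers both orders of the arguments without
    appeal to symmetry of the distance.\<close>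
  have z: "GH_filtered F ?F = 0" "GH_filtered ?F F = 0" "GH_filtered G ?G = 0" "GH_filtered ?G G = 0"
    using F G F' G' by (simp_all add: GH_filtered_iso filtration_iso_sym)
  show ?thesis
  proof (rule antisym)
    have "GH_filtered ?F ?G \<le> GH_filtered ?F F + GH_filtered F ?G"
      by (rule GH_filtered_triangle) fact+
    also have "GH_filtered F ?G \<le> GH_filtered F G + GH_filtered G ?G"
      by (rule GH_filtered_triangle) fact+
    finally show "GH_filtration F G \<le> GH_filtered F G" by (simp add: z GH_filtration_def)
    have "GH_filtered F G \<le> GH_filtered F ?F + GH_filtered ?F G"
      by (rule GH_filtered_triangle) fact+
    also have "GH_filtered ?F G \<le> GH_filtered ?F ?G + GH_filtered ?G G"
      by (rule GH_filtered_triangle) fact+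
    finally show "GH_filtered F G \<le> GH_filtration F G" by (simp add: z GH_filtration_def)
  qed
qed

section \<open>The filtration associated with a metric space\<close>

lemma level_met_filtration: "level (met_filtration M) t = (if t < 0 then {} else mspace M)"
  by (simp add: met_filtration_def)

lemma level_met_filtration_nonneg: "0 \<le> t \<Longrightarrow> level (met_filtration M) t = mspace M"
  by (simp add: level_met_filtration)

lemma level_met_filtration_mono:
  "s \<le> t \<Longrightarrow> level (met_filtration M) s \<subseteq> level (met_filtration M) t"
  by (simp add: level_met_filtration)

lemma clos_met_filtration:
  assumes "A \<subseteq> level (met_filtration M) t"
  shows "clos (met_filtration M) t A = {x \<in> level (met_filtration M) t. \<exists>a\<in>A. mdist M a x \<le> t}"
  using assms by (simp add: met_filtration_def Let_def)

lemma tmap_met_filtration: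
  "tmap (met_filtration M) s t = (if s \<le> t then \<lambda>x\<in>level (met_filtration M) s. x else undefined)"
  by (simp add: met_filtration_def Let_def)

lemma total_space_met_filtration: "total_space (met_filtration M) = mspace M"
  by (auto simp: total_space_def level_met_filtration intro: exI[of _ 0])

lemma closure_space_met_filtration:
  "closure_space (level (met_filtration M) t) (clos (met_filtration M) t)"
  unfolding closure_space_def
proof (intro conjI allI impI)
  show "clos (met_filtration M) t
      \<in> Pow (level (met_filtration M) t) \<rightarrow>\<^sub>E Pow (level (met_filtration M) t)"
    by (auto simp: met_filtration_def Let_def)
  show "clos (met_filtration M) t {} = {}"
    by (simp add: clos_met_filtration)
  fix A assume A: "A \<subseteq> level (met_filtration M) t"
  \<comment> \<open>Negative levels are empty, so the mere existence of \<open>a\<close> forces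
    \<open>0 \<le> t\<close>.\<close>
  moreover have "mdist M a a \<le> t" if "a \<in> A" for a
  proof -
    from that A have "a \<in> mspace M" and "0 \<le> t"
      by (auto simp: level_met_filtration split: if_splits)
    then show ?thesis
      by (simp add: mdist_zero[THEN iffD2])
  qed
  ultimately show "A \<subseteq> clos (met_filtration M) t A"
    by (auto simp: clos_met_filtration)
  fix B assume "B \<subseteq> level (met_filtration M) t"
  with A show "clos (met_filtration M) t (A \<union> B)
      = clos (met_filtration M) t A \<union> clos (met_filtration M) t B"
    by (auto simp: clos_met_filtration)
qed

lemma filtered_closure_space_met_filtration: "filtered_closure_space (met_filtration M)"
proof -
  let ?F = "met_filtration M"
  have "(\<lambda>x\<in>level ?F s. x) \<in> closure_maps (level ?F s) (clos ?F s) (level ?F t) (clos ?F t)"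
    if st: "s \<le> t" for s t
    unfolding closure_maps_def
  proof (intro CollectI conjI allI impI)
    show "(\<lambda>x\<in>level ?F s. x) \<in> level ?F s \<rightarrow>\<^sub>E level ?F t"
      using st by (auto simp: level_met_filtration)
    fix A assume A: "A \<subseteq> level ?F s"
    then have At: "A \<subseteq> level ?F t" and im: "(\<lambda>x\<in>level ?F s. x) ` A = A"
      using st by (force simp: level_met_filtration split: if_splits)+
    show "(\<lambda>x\<in>level ?F s. x) ` clos ?F s A \<subseteq> clos ?F t ((\<lambda>x\<in>level ?F s. x) ` A)"
      unfolding im using A At st
      by (force simp: clos_met_filtration level_met_filtration split: if_splits)
  qed
  then show ?thesis
    unfolding filtered_closure_space_def is_filtration_def
    using closure_space_met_filtration[of M] level_met_filtration_mono[of _ _ M]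
    by (auto simp: tmap_met_filtration inj_on_def subset_iff)
qed

lemma is_filtration_met_filtration: "is_filtration (met_filtration M)"
  using filtered_closure_space_met_filtration[of M] by (simp add: filtered_closure_space_def)

text \<open>From metric to filtered, any subordinate \<open>f\<close> works, since
  \<open>(a, f a) \<in> C\<close> turns \<open>d(a, x) \<le> t\<close> into a bound on the distance
  from \<open>f a\<close> to \<open>y\<close>. The converse tests singletons at
  \<open>t = d(x, x')\<close>.\<close>

lemma filtered_multivalued_map_met_filtration:
  assumes "0 \<le> \<epsilon>"
  shows "filtered_multivalued_map \<epsilon> (met_filtration M) (met_filtration N) C
    \<longleftrightarrow> metric_multivalued_map \<epsilon> M N C"
proof
  assume C: "metric_multivalued_map \<epsilon> M N C"
  then have sub: "C \<subseteq> mspace M \<times> mspace N" and mv: "multivalued_map (mspace M) (mspace N) C"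
    and d: "\<And>x y x' y'. (x, y) \<in> C \<Longrightarrow> (x', y') \<in> C \<Longrightarrow> mdist N y y' \<le> mdist M x x' + \<epsilon>"
    unfolding metric_multivalued_map_def multivalued_map_def by blast+
  \<comment> \<open>Since \<open>0 \<le> \<epsilon>\<close>, a nonnegative \<open>t\<close> stays
    nonnegative after the shift, where the level of \<open>N\<close> is the whole space.\<close>
  have lev: "y \<in> level (met_filtration N) (t + \<epsilon>)"
    if "x \<in> level (met_filtration M) t" "(x, y) \<in> C" for t x y
    using that sub assms by (auto simp: level_met_filtration split: if_splits)
  have "C `` clos (met_filtration M) t A \<subseteq> clos (met_filtration N) (t + \<epsilon>) (f ` A)"
    if A: "A \<subseteq> level (met_filtration M) t" and f: "subordinate (mspace M) (mspace N) C f" for t A f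
  proof -
    have fC: "(a, f a) \<in> C" if "a \<in> A" for a
      using that A f by (auto simp: subordinate_def level_met_filtration split: if_splits)
    have fA: "f ` A \<subseteq> level (met_filtration N) (t + \<epsilon>)"
      using fC lev A by blast
    show ?thesis
    proof
      fix y assume "y \<in> C `` clos (met_filtration M) t A"
      then obtain x a where xy: "(x, y) \<in> C" "x \<in> level (met_filtration M) t"
        and a: "a \<in> A" "mdist M a x \<le> t"
        using A by (auto simp: clos_met_filtration)
      have "mdist N (f a) y \<le> t + \<epsilon>"
        using d[OF fC[OF a(1)] xy(1)] a(2) by simp
      then show "y \<in> clos (met_filtration N) (t + \<epsilon>) (f ` A)"
        using lev[OF xy(2,1)] a(1) by (auto simp: clos_met_filtration[OF fA])
    qed
  qed
  then show "filtered_multivalued_map \<epsilon> (met_filtration M) (met_filtration N) C"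
    using mv lev by (auto simp: filtered_multivalued_map_def total_space_met_filtration)
next
  assume C: "filtered_multivalued_map \<epsilon> (met_filtration M) (met_filtration N) C"
  then have mv: "multivalued_map (mspace M) (mspace N) C"
    by (simp add: filtered_multivalued_map_def total_space_met_filtration)
  have "mdist N y y' \<le> mdist M x x' + \<epsilon>" if xy: "(x, y) \<in> C" "(x', y') \<in> C" for x y x' y'
  proof -
    let ?t = "mdist M x x'"
    have mem: "x \<in> mspace M" "x' \<in> mspace M" "y \<in> mspace N" "y' \<in> mspace N"
      using mv xy by (auto simp: multivalued_map_def)
    have "\<forall>u\<in>mspace M. \<exists>v. (u, v) \<in> C"
      using mv by (auto simp: multivalued_map_def)
    then obtain g where g: "\<And>u. u \<in> mspace M \<Longrightarrow> (u, g u) \<in> C"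
      by metis
    \<comment> \<open>An arbitrary selection \<open>g\<close> is redirected at \<open>x\<close>, so
      that \<open>f\<close> takes the prescribed value \<open>y\<close> there and stays subordinate
      to \<open>C\<close>.\<close>
    define f where "f = g(x := y)"
    have f: "subordinate (mspace M) (mspace N) C f"
      using g xy mv by (auto simp: f_def subordinate_def multivalued_map_def Pi_iff)
    have "C `` clos (met_filtration M) ?t {x} \<subseteq> clos (met_filtration N) (?t + \<epsilon>) (f ` {x})"
      using C f mem unfolding filtered_multivalued_map_def total_space_met_filtration
      by (auto simp: level_met_filtration_nonneg simp del: image_insert)
    moreover have "x' \<in> clos (met_filtration M) ?t {x}"
      using mem by (simp add: clos_met_filtration level_met_filtration_nonneg)
    ultimately have "y' \<in> clos (met_filtration N) (?t + \<epsilon>) {y}"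
      using xy(2) by (auto simp: f_def)
    moreover have "{y} \<subseteq> level (met_filtration N) (?t + \<epsilon>)"
      using mem assms by (simp add: level_met_filtration_nonneg)
    ultimately show ?thesis by (simp add: clos_met_filtration)
  qed
  then show "metric_multivalued_map \<epsilon> M N C"
    using mv by (auto simp: metric_multivalued_map_def)
qed

text \<open>For each \<open>C\<close> both distortions are infima over the same set of
  \<open>\<epsilon> \<ge> 0\<close>, so no limiting argument occurs.\<close>

lemma GH_filtered_met_filtration: "GH_filtered (met_filtration M) (met_filtration N) = GH_metric M N"
proof -
  have "filtered_correspondence \<epsilon> (met_filtration M) (met_filtration N) C
      \<longleftrightarrow> metric_correspondence \<epsilon> M N C" if "0 \<le> \<epsilon>" for \<epsilon> C
    using that by (simp add: filtered_correspondence_def metric_correspondence_def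
        filtered_multivalued_map_met_filtration total_space_met_filtration)
  then have "{\<epsilon>. 0 \<le> \<epsilon> \<and> filtered_correspondence \<epsilon> (met_filtration M) (met_filtration N) C}
      = {\<epsilon>. 0 \<le> \<epsilon> \<and> metric_correspondence \<epsilon> M N C}" for C
    by blast
  then show ?thesis
    by (simp add: GH_filtered_def GH_metric_def filtered_distortion_def metric_distortion_def
        total_space_met_filtration)
qed

section \<open>The full embedding\<close>

lemma Met_simps:
  "Hom Met = lipschitz1_maps" "Ident Met = (\<lambda>M. \<lambda>x\<in>mspace M. x)" "Comp Met = (\<lambda>M. compose (mspace M))"
  by (simp_all add: Met_def)

lemma FRCl_simps:
  "Obj FRCl = Collect is_filtration" "Hom FRCl = filtration_maps" "Ident FRCl = filtration_id"
  "Comp FRCl = filtration_comp"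
  by (simp_all add: FRCl_def)

lemma lipschitz1_maps_compose:
  assumes f: "f \<in> lipschitz1_maps M N" and g: "g \<in> lipschitz1_maps N K"
  shows "compose (mspace M) g f \<in> lipschitz1_maps M K"
proof -
  have fN: "f x \<in> mspace N" if "x \<in> mspace M" for x
    using f that by (auto simp: lipschitz1_maps_def)
  have gK: "g y \<in> mspace K" if "y \<in> mspace N" for y
    using g that by (auto simp: lipschitz1_maps_def)
  have "mdist K (g (f x)) (g (f x')) \<le> mdist M x x'" if x: "x \<in> mspace M" "x' \<in> mspace M" for x x'
  proof -
    have "mdist K (g (f x)) (g (f x')) \<le> mdist N (f x) (f x')"
      using g fN x by (simp add: lipschitz1_maps_def)
    also have "\<dots> \<le> mdist M x x'"
      using f x by (simp add: lipschitz1_maps_def)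
    finally show ?thesis .
  qed
  with fN gK show ?thesis
    by (simp add: lipschitz1_maps_def compose_def)
qed

lemma is_category_Met: "is_category Met"
proof -
  have ext: "f \<in> mspace M \<rightarrow> mspace N" "f \<in> extensional (mspace M)"
    if "f \<in> lipschitz1_maps M N" for M N :: "'a metric" and f
    using that by (simp_all add: lipschitz1_maps_def PiE_def)
  have "(\<lambda>x\<in>mspace M. x) \<in> lipschitz1_maps M M" for M :: "'a metric"
    by (simp add: lipschitz1_maps_def)
  moreover have "compose (mspace M) f (\<lambda>x\<in>mspace M. x) = f" "compose (mspace M) (\<lambda>x\<in>mspace N. x) f = f"
    if "f \<in> lipschitz1_maps M N" for M N :: "'a metric" and f
    by (rule compose_Id[OF ext[OF that]] Id_compose[OF ext[OF that]])+
  moreover have "compose (mspace L) h (compose (mspace L) g f)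
      = compose (mspace L) (compose (mspace M) h g) f"
    if "f \<in> lipschitz1_maps L M" for L M :: "'a metric" and f g h :: "'a \<Rightarrow> 'a"
    by (rule compose_assoc[OF ext(1)[OF that]])
  ultimately show ?thesis
    unfolding is_category_def Met_simps by (simp add: lipschitz1_maps_compose)
qed

text \<open>The hypothesis on \<open>c\<close> keeps \<open>c A\<close> inside \<open>X\<close>,
  where \<open>compose X g f\<close> agrees with applying \<open>f\<close> and then
  \<open>g\<close>.\<close>

lemma closure_maps_compose:
  assumes c: "closure_space X c" and f: "f \<in> closure_maps X c Y c'" and g: "g \<in> closure_maps Y c' Z c''"
  shows "compose X g f \<in> closure_maps X c Z c''"
proof -
  have fY: "f \<in> X \<rightarrow> Y" and gZ: "g \<in> Y \<rightarrow> Z"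
    using f g by (auto simp: closure_maps_def)
  have im: "compose X g f ` A = g ` f ` A" if "A \<subseteq> X" for A
    using that by (auto simp: compose_def image_image subset_iff intro!: image_cong)
  have "compose X g f ` c A \<subseteq> c'' (compose X g f ` A)" if A: "A \<subseteq> X" for A
  proof -
    have fA: "f ` A \<subseteq> Y" using A fY by auto
    have "g ` f ` c A \<subseteq> g ` c' (f ` A)"
      using f A unfolding closure_maps_def by blast
    also have "\<dots> \<subseteq> c'' (g ` f ` A)"
      using g fA unfolding closure_maps_def by blast
    finally show ?thesis
      using A closure_space_subset[OF c A] by (simp add: im)
  qed
  then show ?thesis
    using fY gZ by (auto simp: closure_maps_def compose_def)
qed

lemma filtration_comp_in_filtration_maps:
  assumes F: "is_filtration F" and \<eta>: "\<eta> \<in> filtration_maps F G" and \<theta>: "\<theta> \<in> filtration_maps G H"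
  shows "filtration_comp F \<theta> \<eta> \<in> filtration_maps F H"
proof -
  have "closure_space (level F t) (clos F t)" for t
    using F by (simp add: is_filtration_def)
  moreover have "tmap F s t x \<in> level F t" if "s \<le> t" "x \<in> level F s" for s t x
    using F that unfolding is_filtration_def closure_maps_def by blast
  moreover have "\<eta> t x \<in> level G t" if "x \<in> level F t" for t x
    using \<eta> that unfolding filtration_maps_def closure_maps_def by blast
  ultimately show ?thesis
    using \<eta> \<theta> by (auto simp: filtration_maps_def filtration_comp_def compose_eq
        intro: closure_maps_compose)
qed

lemma is_category_FRCl: "is_category FRCl"
proof -
  have ext: "\<eta> t \<in> level F t \<rightarrow> level G t" "\<eta> t \<in> extensional (level F t)"
    if "\<eta> \<in> filtration_maps F G" for F G :: "'a filtration" and \<eta> t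
    using that by (auto simp: filtration_maps_def closure_maps_def PiE_def)
  have "filtration_comp F \<eta> (filtration_id F) = \<eta>" "filtration_comp F (filtration_id G) \<eta> = \<eta>"
    if "\<eta> \<in> filtration_maps F G" for F G :: "'a filtration" and \<eta>
    by (simp_all add: filtration_comp_def filtration_id_def compose_Id[OF ext[OF that]]
        Id_compose[OF ext[OF that]])
  moreover have "filtration_comp E \<kappa> (filtration_comp E \<theta> \<eta>) = filtration_comp E (filtration_comp F \<kappa> \<theta>) \<eta>"
    if "\<eta> \<in> filtration_maps E F" for E F :: "'a filtration" and \<eta> \<theta> \<kappa> :: "real \<Rightarrow> 'a \<Rightarrow> 'a"
    by (simp add: filtration_comp_def compose_assoc[OF ext(1)[OF that]])
  ultimately show ?thesis
    by (simp add: is_category_def FRCl_simps filtration_id_in_filtration_maps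
        filtration_comp_in_filtration_maps)
qed

text \<open>A 1-Lipschitz map preserves every condition \<open>d(a, x) \<le> t\<close>, hence is
  continuous at every level; restrictions of one function commute with inclusions.\<close>

lemma met_filtration_map_in_filtration_maps:
  assumes f: "f \<in> lipschitz1_maps M N"
  shows "met_filtration_map M N f \<in> filtration_maps (met_filtration M) (met_filtration N)"
proof -
  let ?X = "level (met_filtration M)" and ?Y = "level (met_filtration N)"
  have mem: "f x \<in> ?Y t" if "x \<in> ?X t" for x t
    using f that by (auto simp: lipschitz1_maps_def level_met_filtration split: if_splits)
  have lip: "mdist N (f x) (f x') \<le> mdist M x x'" if "x \<in> ?X t" "x' \<in> ?X t" for x x' t
    using f that by (auto simp: lipschitz1_maps_def level_met_filtration split: if_splits)
  have "restrict f (?X t) \<in> closure_maps (?X t) (clos (met_filtration M) t) (?Y t) (clos (met_filtration N) t)"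
    for t
    unfolding closure_maps_def
  proof (intro CollectI conjI allI impI)
    show "restrict f (?X t) \<in> ?X t \<rightarrow>\<^sub>E ?Y t"
      using mem by auto
    fix A assume A: "A \<subseteq> ?X t"
    have im: "restrict f (?X t) ` A = f ` A"
      using A by (auto simp: subset_iff)
    have fA: "f ` A \<subseteq> ?Y t"
      using A mem by auto
    show "restrict f (?X t) ` clos (met_filtration M) t A
        \<subseteq> clos (met_filtration N) t (restrict f (?X t) ` A)"
      unfolding im
    proof
      fix y assume "y \<in> restrict f (?X t) ` clos (met_filtration M) t A"
      then obtain x a where x: "x \<in> ?X t" "y = f x" and a: "a \<in> A" "mdist M a x \<le> t"
        by (auto simp: clos_met_filtration[OF A])
      have "mdist N (f a) y \<le> t"
        using lip[of a t x] x a A by auto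
      then show "y \<in> clos (met_filtration N) t (f ` A)"
        using x a mem by (auto simp: clos_met_filtration[OF fA])
    qed
  qed
  then show ?thesis
    using mem level_met_filtration_mono[of _ _ M]
    by (auto simp: filtration_maps_def met_filtration_map_def tmap_met_filtration subset_iff)
qed

text \<open>Fullness: \<open>f\<close> is the component \<open>\<eta> 0\<close>. It determines the
  components at \<open>t \<ge> 0\<close> by level independence, and the levels at
  \<open>t < 0\<close> are empty.\<close>

lemma filtration_maps_met_filtrationE:
  assumes \<eta>: "\<eta> \<in> filtration_maps (met_filtration M) (met_filtration N)"
  obtains f where "f \<in> lipschitz1_maps M N" and "\<eta> = met_filtration_map M N f"
proof
  let ?X = "level (met_filtration M)" and ?Y = "level (met_filtration N)"
  have cont: "\<eta> t ` clos (met_filtration M) t A \<subseteq> clos (met_filtration N) t (\<eta> t ` A)"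
    if "A \<subseteq> ?X t" for t A
    using \<eta> that unfolding filtration_maps_def closure_maps_def by blast
  have e: "\<eta> t \<in> ?X t \<rightarrow>\<^sub>E ?Y t" for t
    using \<eta> unfolding filtration_maps_def closure_maps_def by blast
  have indep: "\<eta> t x = \<eta> 0 x" if "0 \<le> t" "x \<in> mspace M" for t x
    using that
    by (intro filtration_map_level_indep[OF filtered_closure_space_met_filtration
          filtered_closure_space_met_filtration \<eta>]) (simp_all add: level_met_filtration)
  have e0: "\<eta> 0 \<in> mspace M \<rightarrow>\<^sub>E mspace N"
    using e[of 0] by (simp add: level_met_filtration)
  have "mdist N (\<eta> 0 x) (\<eta> 0 x') \<le> mdist M x x'" if x: "x \<in> mspace M" "x' \<in> mspace M" for x x'
  proof -
    let ?t = "mdist M x x'"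
    have "x' \<in> clos (met_filtration M) ?t {x}"
      using x by (simp add: clos_met_filtration level_met_filtration_nonneg)
    then have "\<eta> ?t x' \<in> clos (met_filtration N) ?t {\<eta> ?t x}"
      using cont[of "{x}" ?t] x by (auto simp: level_met_filtration_nonneg)
    then have "\<eta> 0 x' \<in> clos (met_filtration N) ?t {\<eta> 0 x}"
      using x by (simp add: indep[of ?t])
    moreover have "{\<eta> 0 x} \<subseteq> ?Y ?t"
      using e0 x by (auto simp: level_met_filtration_nonneg)
    ultimately show ?thesis
      by (simp add: clos_met_filtration)
  qed
  then show "\<eta> 0 \<in> lipschitz1_maps M N"
    using e0 by (simp add: lipschitz1_maps_def)
  show "\<eta> = met_filtration_map M N (\<eta> 0)"
  proof (intro ext)
    fix t x
    show "\<eta> t x = met_filtration_map M N (\<eta> 0) t x"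
    proof (cases "x \<in> ?X t")
      case True
      then show ?thesis
        by (auto simp: met_filtration_map_def level_met_filtration indep[of t x] split: if_splits)
    next
      \<comment> \<open>Off the level both sides are \<open>undefined\<close>; this includes every
        \<open>t < 0\<close>.\<close>
      case False
      then show ?thesis
        using PiE_arb[OF e[of t] False] by (simp add: met_filtration_map_def)
    qed
  qed
qed

text \<open>Level 0 is the whole space, so an extensional map is recovered from its component at 0;
  surjectivity is the preceding elimination rule.\<close>

lemma bij_betw_met_filtration_map:
  "bij_betw (met_filtration_map M N) (lipschitz1_maps M N)
    (filtration_maps (met_filtration M) (met_filtration N))"
  unfolding bij_betw_def
proof
  show "inj_on (met_filtration_map M N) (lipschitz1_maps M N)"
  proof (rule inj_onI)
    fix f g assume fg: "f \<in> lipschitz1_maps M N" "g \<in> lipschitz1_maps M N"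
      and "met_filtration_map M N f = met_filtration_map M N g"
    then have "restrict f (mspace M) = restrict g (mspace M)"
      by (auto simp: met_filtration_map_def level_met_filtration dest: fun_cong[of _ _ 0])
    moreover have "restrict f (mspace M) = f" "restrict g (mspace M) = g"
      using fg unfolding lipschitz1_maps_def by (blast intro: PiE_restrict)+
    ultimately show "f = g" by simp
  qed
  show "met_filtration_map M N ` lipschitz1_maps M N
      = filtration_maps (met_filtration M) (met_filtration N)"
    using met_filtration_map_in_filtration_maps
    by (auto elim!: filtration_maps_met_filtrationE)
qed

text \<open>Closures of singletons record which \<open>t \<ge> 0\<close> bound a distance, and so
  determine it.\<close>

lemma inj_on_met_filtration: "inj_on met_filtration (Obj Met)"
proof (rule inj_onI)
  fix M N :: "'a metric"
  assume M: "M \<in> Obj Met" and N: "N \<in> Obj Met" and eq: "met_filtration M = met_filtration N"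
  have X: "mspace M = mspace N"
    using arg_cong[OF eq, of total_space] by (simp add: total_space_met_filtration)
  have le: "mdist M x y \<le> t \<longleftrightarrow> mdist N x y \<le> t"
    if "x \<in> mspace M" "y \<in> mspace M" "0 \<le> t" for x y t
  proof -
    have "y \<in> clos (met_filtration M) t {x} \<longleftrightarrow> y \<in> clos (met_filtration N) t {x}"
      by (simp add: eq)
    then show ?thesis
      using that X by (simp add: clos_met_filtration level_met_filtration)
  qed
  have "mdist M x y = mdist N x y" for x y
  proof (cases "x \<in> mspace M \<and> y \<in> mspace M")
    case True
    then show ?thesis
      \<comment> \<open>Testing at each of the two distances gives both inequalities.\<close>
      using le[of x y "mdist M x y"] le[of x y "mdist N x y"] by simp
  next
    case False
    \<comment> \<open>Off the carrier both distances are 0, by the normal form demanded of objects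
      of \<open>Met\<close>.\<close>
    then show ?thesis
      using M N X by (simp add: Met_def)
  qed
  then have "mdist M = mdist N" by blast
  with X show "M = N"
    by (metis metric_collapse)
qed

lemma full_embedding_met_filtration:
  "full_embedding (Met :: ('a metric, 'a \<Rightarrow> 'a) category) FRCl met_filtration met_filtration_map"
proof -
  have "met_filtration_map M M (\<lambda>x\<in>mspace M. x) = filtration_id (met_filtration M)" for M :: "'a metric"
    by (auto simp: met_filtration_map_def filtration_id_def level_met_filtration fun_eq_iff)
  \<comment> \<open>Restrictions compose level by level because \<open>f\<close> sends each level of
    \<open>M\<close> into the same level of \<open>N\<close>.\<close>
  moreover have "met_filtration_map M K (compose (mspace M) g f)
      = filtration_comp (met_filtration M) (met_filtration_map N K g) (met_filtration_map M N f)"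
    if "f \<in> lipschitz1_maps M N" for M N K :: "'a metric" and f g
    using that by (auto simp: met_filtration_map_def filtration_comp_def level_met_filtration
        compose_def fun_eq_iff lipschitz1_maps_def)
  ultimately have "is_functor (Met :: ('a metric, 'a \<Rightarrow> 'a) category) FRCl met_filtration met_filtration_map"
    unfolding is_functor_def Met_simps FRCl_simps
    by (blast intro: is_category_Met is_category_FRCl is_filtration_met_filtration
        met_filtration_map_in_filtration_maps)
  then show ?thesis
    by (simp add: full_embedding_def Met_simps FRCl_simps inj_on_met_filtration
        bij_betw_met_filtration_map)
qed

lemma GH_filtration_met_filtration:
  "GH_filtration (met_filtration M) (met_filtration N) = GH_metric M N"
  by (simp add: GH_filtration_eq_GH_filtered filtered_closure_space_met_filtration
      GH_filtered_met_filtration)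

text \<open>The Lawvere statement compares spaces over one point type \<open>'a\<close>; the
  separate \<open>M\<close> and \<open>N\<close> give the equality of distances across two point
  types as well.\<close>

theorem theorem8p19:
  fixes M :: "'b metric" and N :: "'c metric"
  shows "full_embedding (Met :: ('a metric, 'a \<Rightarrow> 'a) category) FRCl met_filtration met_filtration_map
     \<and> lawvere_isometric_embedding (Obj (Met :: ('a metric, 'a \<Rightarrow> 'a) category)) GH_metric
         (Obj FRCl) GH_filtration met_filtration
     \<and> filtered_closure_space (met_filtration M) \<and> filtered_closure_space (met_filtration N)
     \<and> GH_filtered (met_filtration M) (met_filtration N) = GH_metric M N
     \<and> GH_filtration (met_filtration M) (met_filtration N) = GH_metric M N"
proof -
  have "lawvere_metric_space (Obj FRCl) GH_filtration"
    by (simp add: lawvere_metric_space_def FRCl_simps GH_filtration_self GH_filtration_triangle)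
  then show ?thesis
    by (simp add: lawvere_isometric_embedding_def lawvere_metric_space_def GH_metric_self
        GH_metric_triangle full_embedding_met_filtration filtered_closure_space_met_filtration
        is_filtration_met_filtration GH_filtered_met_filtration GH_filtration_met_filtration FRCl_simps)
qed

end
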